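(* Let $\mathbb{X}\subseteq\mathbb{R}^n$, $b\in\mathbb{R}$, $\epsilon\in[0,1)$, let $\ell$ be a positive integer, $\Lambda=\{0,1,\dots,\ell\}$, $\lambda_i=i/\ell$. Let $\pi$ be the joint possibility distribution described in the context, built with the deviation function $\delta(\boldsymbol{a})=\|\boldsymbol{a}-\hat{\boldsymbol{a}}\|_1=\sum_{j\in[n]}|a_j-\hat a_j|$, so that $$\mathcal{C}(\lambda_i)=\{\boldsymbol{a}\in\mathbb{R}^n:\ \underline{\boldsymbol{a}}(\lambda_i)\le\boldsymbol{a}\le\overline{\boldsymbol{a}}(\lambda_i),\ \|\boldsymbol{a}-\hat{\boldsymbol{a}}\|_1\le\overline{\delta}(\lambda_i)\},\quad i\in\Lambda.$$ Then for every $\boldsymbol{x}\in\mathbb{X}$ the constraint $$\sup_{\mathrm{P}\in\mathcal{P}^{\ell}_\pi}\mathrm{CVaR}^{\epsilon}_{\mathrm{P}}[\tilde{\boldsymbol{a}}^T\boldsymbol{x}]\le b$$ is equivalent to the following system of linear constraints, i.e. it holds if and only if there exist $w,t\in\mathbb{R}$, $v_i,\gamma_i\in\mathbb{R}$ and $\boldsymbol{\alpha}_i,\boldsymbol{\beta}_i,\boldsymbol{\phi}_i,\boldsymbol{\xi}_i\in\mathbb{R}^n$ ($i\in\Lambda$) such that $$\begin{aligned} & w+\sum_{i\in\Lambda}(\lambda_i-1)v_i\le(b-t)(1-\epsilon),\\ & w-\sum_{j\le i}v_j\ge 0 && \forall i\in\Lambda,\\ & w-\sum_{j\le i}v_j+t\ge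 \overline{\boldsymbol{a}}(\lambda_i)^T\boldsymbol{\alpha}_i-\underline{\boldsymbol{a}}(\lambda_i)^T\boldsymbol{\beta}_i+\hat{\boldsymbol{a}}^T(\boldsymbol{\phi}_i-\boldsymbol{\xi}_i)+\overline{\delta}(\lambda_i)\gamma_i && \forall i\in\Lambda,\\ & \alpha_{ij}-\beta_{ij}+\phi_{ij}-\xi_{ij}=x_j && \forall j\in[n],\ \forall i\in\Lambda,\\ & \gamma_{i}-\phi_{ij}-\xi_{ij}\ge 0 && \forall j\in[n],\ \forall i\in\Lambda,\\ & \boldsymbol{\alpha}_i,\boldsymbol{\beta}_i,\boldsymbol{\phi}_i,\boldsymbol{\xi}_i\in\mathbb{R}^n_+ && \forall i\in\Lambda,\\ & v_i,\gamma_i\ge 0 && \forall i\in\Lambda, \end{aligned}$$ where $\sum_{j\le i}$ denotes summation over $j\in\{0,\dots,i\}$.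
   Context: Notation: $[n]=\{1,\dots,n\}$. For $\epsilon\in[0,1)$ and a real random variable $\mathrm{X}$, $\mathrm{CVaR}^{\epsilon}_{\mathrm{P}}[\mathrm{X}]=\inf_{t\in\mathbb{R}}\big(t+\frac{1}{1-\epsilon}\mathbb{E}_{\mathrm{P}}[[\mathrm{X}-t]_+]\big)$ with $[y]_+=\max\{0,y\}$. Joint possibility distribution. Given are $\hat{\boldsymbol{a}}=(\hat a_1,\dots,\hat a_n)\in\mathbb{R}^n$ (nominal scenario), deviations $\underline{a}_j,\overline{a}_j>0$ ($j\in[n]$) and a budget $\overline{\delta}>0$. For each $j\in[n]$, $\pi_{\tilde a_j}:\mathbb{R}\to[0,1]$ is continuous, equals $1$ at $\hat a_j$, is strictly increasing on $[\hat a_j-\underline{a}_j,\hat a_j]$, strictly decreasing on $[\hat a_j,\hat a_j+\overline{a}_j]$, and equals $0$ outside $[\hat a_j-\underline{a}_j,\hat a_j+\overline{a}_j]$. The function $\pi_{\tilde\delta}:[0,\infty)\to[0,1]$ is continuous, $\pi_{\tilde\delta}(0)=1$, strictly decreasing on $[0,\overline{\delta}]$, and $0$ on $[\overline{\delta},\infty)$. Set $$\pi(\boldsymbol{a})=\min\{\pi_{\tilde a_1}(a_1),\dots,\pi_{\tilde a_n}(a_n),\pi_{\tilde\delta}(\delta(\boldsymbol{a}))\}.$$ For $\lambda\in(0,1]$, $[\underline{a}_j(\lambda),\overline{a}_j(\lambda)]=\{y:\pi_{\tilde a_j}(y)\ge\lambda\}$ and $[0,\overline{\delta}(\lambda)]=\{y\ge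 0:\pi_{\tilde\delta}(y)\ge\lambda\}$; for $\lambda=0$, $\underline{a}_j(0)=\hat a_j-\underline{a}_j$, $\overline{a}_j(0)=\hat a_j+\overline{a}_j$, $\overline{\delta}(0)=\overline{\delta}$. (For example, for $\pi_{\tilde a_j}(y)=(1+\frac{y-\hat a_j}{\underline a_j})^{1/z_1}$ to the left and $(1+\frac{\hat a_j-y}{\overline a_j})^{1/z_2}$ to the right of $\hat a_j$ within its support, and $\pi_{\tilde\delta}(y)=(1-y/\overline\delta)^{1/z}$ on $[0,\overline\delta]$, with $z_1,z_2,z>0$, one has $\underline a_j(\lambda)=\hat a_j-\underline a_j(1-\lambda^{z_1})$, $\overline a_j(\lambda)=\hat a_j+\overline a_j(1-\lambda^{z_2})$, $\overline\delta(\lambda)=\overline\delta(1-\lambda^{z})$.) Write $\underline{\boldsymbol{a}}(\lambda)=(\underline{a}_j(\lambda))_{j\in[n]}$, $\overline{\boldsymbol{a}}(\lambda)=(\overline{a}_j(\lambda))_{j\in[n]}$. The confidence sets are $\mathcal{C}(\lambda)=\{\boldsymbol{a}:\pi(\boldsymbol{a})\ge\lambda\}=\{\boldsymbol{a}:\underline{\boldsymbol{a}}(\lambda)\le\boldsymbol{a}\le\overline{\boldsymbol{a}}(\lambda),\ \delta(\boldsymbol{a})\le\overline{\delta}(\lambda)\}$ for $\lambda\in(0,1]$ and $\mathcal{C}(0)=\{\boldsymbol{a}:\underline{\boldsymbol{a}}(0)\le\boldsymbol{a}\le\overline{\boldsymbol{a}}(0),\ \delta(\boldsymbol{a})\le\overline{\delta}\}=\mathcal{U}$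 (scenario set). Ambiguity set: $\mathcal{P}^{\ell}_\pi$ is the set of all Borel probability distributions $\mathrm{P}$ on $\mathcal{U}$ with $\mathrm{P}(\mathcal{C}(\lambda_i))\ge 1-\lambda_i$ for all $i\in\Lambda$; $\tilde{\boldsymbol{a}}$ is the random vector with distribution $\mathrm{P}$. *)

theory Defs
  imports "HOL-Probability.Probability"
begin

text \<open>The infimum is taken in the extended reals, so that it is total.  For integrable \<open>X\<close>
  and \<open>0 \<le> \<epsilon> < 1\<close> it is finite, being bounded below by the expectation of \<open>X\<close>.\<close>

definition CVaR :: "real \<Rightarrow> 'a measure \<Rightarrow> ('a \<Rightarrow> real) \<Rightarrow> ereal" where
  "CVaR \<epsilon> P X = (INF t::real. ereal (t + 1 / (1 - \<epsilon>) * (LINT a|P. max 0 (X a - t))))"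

text \<open>Below, \<open>c\<close> is the nominal scenario, \<open>dl\<close> and \<open>du\<close> are the downward and upward
  deviations, \<open>D\<close> is the budget, \<open>p\<close> and \<open>q\<close> are the possibility distributions of the
  components and of the deviation, and \<open>\<delta>\<close> is the deviation function.\<close>

definition component_possibility :: "real \<Rightarrow> real \<Rightarrow> real \<Rightarrow> (real \<Rightarrow> real) \<Rightarrow> bool" where
  "component_possibility c dl du p \<longleftrightarrow>
     continuous_on UNIV p \<and> (\<forall>y. 0 \<le> p y \<and> p y \<le> 1) \<and> p c = 1 \<and>
     strict_mono_on {c - dl..c} p \<and> strict_antimono_on {c..c + du} p \<and>
     (\<forall>y. y \<notin> {c - dl..c + du} \<longrightarrow> p y = 0)"

text \<open>The function is only meant on \<open>{0..}\<close>; its values at negative arguments are irrelevant.\<close>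

definition deviation_possibility :: "real \<Rightarrow> (real \<Rightarrow> real) \<Rightarrow> bool" where
  "deviation_possibility D q \<longleftrightarrow>
     continuous_on {0..} q \<and> (\<forall>y\<ge>0. 0 \<le> q y \<and> q y \<le> 1) \<and> q 0 = 1 \<and>
     strict_antimono_on {0..D} q \<and> (\<forall>y\<ge>D. q y = 0)"

definition joint_possibility ::
  "('n \<Rightarrow> real \<Rightarrow> real) \<Rightarrow> (real \<Rightarrow> real) \<Rightarrow> (real^'n \<Rightarrow> real) \<Rightarrow> real^'n \<Rightarrow> real" where
  "joint_possibility p q \<delta> a = Min (insert (q (\<delta> a)) (range (\<lambda>j. p j (a $ j))))"

definition l1_deviation :: "real^'n \<Rightarrow> real^'n \<Rightarrow> real" where
  "l1_deviation c a = (\<Sum>j\<in>UNIV. \<bar>a $ j - c $ j\<bar>)"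

text \<open>For \<open>0 < \<theta> \<le> 1\<close> the cuts are compact intervals, with the endpoints given here by
  \<open>Inf\<close> and \<open>Sup\<close>; see the lemmas \<open>component_cut\<close> and \<open>deviation_cut\<close> below.\<close>

definition cut_lower :: "real^'n \<Rightarrow> real^'n \<Rightarrow> ('n \<Rightarrow> real \<Rightarrow> real) \<Rightarrow> real \<Rightarrow> real^'n" where
  "cut_lower c dl p \<theta> = (\<chi> j. (if \<theta> = 0 then c $ j - dl $ j else Inf {y. \<theta> \<le> p j y}))"

definition cut_upper :: "real^'n \<Rightarrow> real^'n \<Rightarrow> ('n \<Rightarrow> real \<Rightarrow> real) \<Rightarrow> real \<Rightarrow> real^'n" where
  "cut_upper c du p \<theta> = (\<chi> j. (if \<theta> = 0 then c $ j + du $ j else Sup {y. \<theta> \<le> p j y}))"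

definition cut_deviation :: "real \<Rightarrow> (real \<Rightarrow> real) \<Rightarrow> real \<Rightarrow> real" where
  "cut_deviation D q \<theta> = (if \<theta> = 0 then D else Sup {y. 0 \<le> y \<and> \<theta> \<le> q y})"

definition scenario_set ::
  "real^'n \<Rightarrow> real^'n \<Rightarrow> real^'n \<Rightarrow> real \<Rightarrow> (real^'n \<Rightarrow> real) \<Rightarrow> (real^'n) set" where
  "scenario_set c dl du D \<delta> =
     {a. (\<forall>j. c $ j - dl $ j \<le> a $ j \<and> a $ j \<le> c $ j + du $ j) \<and> \<delta> a \<le> D}"

definition confidence_set ::
  "real^'n \<Rightarrow> real^'n \<Rightarrow> real^'n \<Rightarrow> real \<Rightarrow> ('n \<Rightarrow> real \<Rightarrow> real) \<Rightarrow> (real \<Rightarrow> real) \<Rightarrow>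
   (real^'n \<Rightarrow> real) \<Rightarrow> real \<Rightarrow> (real^'n) set" where
  "confidence_set c dl du D p q \<delta> \<theta> =
     (if \<theta> = 0 then scenario_set c dl du D \<delta> else {a. \<theta> \<le> joint_possibility p q \<delta> a})"

definition level :: "nat \<Rightarrow> nat \<Rightarrow> real" where
  "level l i = real i / real l"

text \<open>The members are probability measures on the Borel subspace \<open>scenario_set\<close>, so
  \<open>space P = scenario_set c dl du D \<delta>\<close>.\<close>

definition ambiguity_set ::
  "real^'n \<Rightarrow> real^'n \<Rightarrow> real^'n \<Rightarrow> real \<Rightarrow> ('n \<Rightarrow> real \<Rightarrow> real) \<Rightarrow> (real \<Rightarrow> real) \<Rightarrow>
   (real^'n \<Rightarrow> real) \<Rightarrow> nat \<Rightarrow> (real^'n) measure set" where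
  "ambiguity_set c dl du D p q \<delta> l =
     {P. prob_space P \<and> sets P = sets (restrict_space borel (scenario_set c dl du D \<delta>)) \<and>
         (\<forall>i\<le>l. measure P (confidence_set c dl du D p q \<delta> (level l i)) \<ge> 1 - level l i)}"

lemma component_cut:
  assumes p: "component_possibility (c $ j) (dl $ j) (du $ j) (p j)"
    and l: "0 < \<theta>" "\<theta> \<le> 1"
  shows "{cut_lower c dl p \<theta> $ j..cut_upper c du p \<theta> $ j} = {y. \<theta> \<le> p j y}"
proof -
  let ?S = "{y. \<theta> \<le> p j y}"
  have cont: "continuous_on UNIV (p j)" and one: "p j (c $ j) = 1"
    and m1: "strict_mono_on {c $ j - dl $ j..c $ j} (p j)"
    and m2: "strict_antimono_on {c $ j..c $ j + du $ j} (p j)"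
    and z: "\<And>y. y \<notin> {c $ j - dl $ j..c $ j + du $ j} \<Longrightarrow> p j y = 0"
    using p unfolding component_possibility_def by blast+
  have sub: "?S \<subseteq> {c $ j - dl $ j..c $ j + du $ j}"
    using z l by force
  have cS: "c $ j \<in> ?S" using one l by simp
  have cl: "closed ?S"
    by (rule closed_Collect_le) (use cont in auto)
  have bb: "bdd_below ?S" and ba: "bdd_above ?S"
    using sub by (meson bdd_below_Icc bdd_above_Icc bdd_below_mono bdd_above_mono)+
  have inS: "Inf ?S \<in> ?S" "Sup ?S \<in> ?S"
    using closed_contains_Inf[OF _ bb cl] closed_contains_Sup[OF _ ba cl] cS by blast+
  have "y \<in> ?S" if y: "Inf ?S \<le> y" "y \<le> Sup ?S" for y
  proof (cases "y \<le> c $ j")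
    case True
    have "p j (Inf ?S) \<le> p j y"
    proof (cases "Inf ?S = y")
      case False
      have "Inf ?S \<in> {c $ j - dl $ j..c $ j}" "y \<in> {c $ j - dl $ j..c $ j}"
        using inS(1) sub y True by (auto simp: subset_iff)
      with False y show ?thesis
        using strict_mono_onD[OF m1, of "Inf ?S" y] by linarith
    qed simp
    with inS(1) show ?thesis by auto
  next
    case False
    have "p j (Sup ?S) \<le> p j y"
    proof (cases "Sup ?S = y")
      case neq: False
      have "Sup ?S \<in> {c $ j..c $ j + du $ j}" "y \<in> {c $ j..c $ j + du $ j}"
        using inS(2) sub y False by (auto simp: subset_iff)
      with neq y show ?thesis
        using monotone_onD[OF m2, of y "Sup ?S"] by force
    qed simp
    with inS(2) show ?thesis by auto
  qed
  moreover have "Inf ?S \<le> y \<and> y \<le> Sup ?S" if "y \<in> ?S" for y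
    using cInf_lower[OF that bb] cSup_upper[OF that ba] by blast
  ultimately have "{Inf ?S..Sup ?S} = ?S"
    unfolding set_eq_iff atLeastAtMost_iff by blast
  then show ?thesis using l by (simp add: cut_lower_def cut_upper_def)
qed

lemma deviation_cut:
  assumes q: "deviation_possibility D q" and l: "0 < \<theta>" "\<theta> \<le> 1"
  shows "{0..cut_deviation D q \<theta>} = {y. 0 \<le> y \<and> \<theta> \<le> q y}"
proof -
  let ?S = "{y. 0 \<le> y \<and> \<theta> \<le> q y}"
  have cont: "continuous_on {0..} q" and one: "q 0 = 1"
    and m: "strict_antimono_on {0..D} q" and z: "\<And>y. y \<ge> D \<Longrightarrow> q y = 0"
    using q unfolding deviation_possibility_def by blast+
  have sub: "?S \<subseteq> {0..D}"
  proof
    fix y assume "y \<in> ?S"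
    with z[of y] l show "y \<in> {0..D}" by (cases "D \<le> y") auto
  qed
  have zS: "0 \<in> ?S" using one l by simp
  have eq: "?S = {y \<in> {0..}. \<theta> \<le> q y}" by auto
  have cl: "closed ?S" unfolding eq
    by (rule continuous_on_closed_Collect_le[OF continuous_on_const cont closed_atLeast])
  have ba: "bdd_above ?S"
    using sub by (meson bdd_above_Icc bdd_above_mono)
  have inS: "Sup ?S \<in> ?S"
    using closed_contains_Sup[OF _ ba cl] zS by blast
  have "y \<in> ?S" if y: "0 \<le> y" "y \<le> Sup ?S" for y
  proof (cases "Sup ?S = y")
    case True
    with inS show ?thesis by simp
  next
    case False
    have S: "Sup ?S \<in> {0..D}" using inS sub by blast
    then have "y \<in> {0..D}"
      using y unfolding atLeastAtMost_iff by linarith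
    with S False y have "q (Sup ?S) < q y"
      using monotone_onD[OF m, of y "Sup ?S"] by force
    with inS y show ?thesis by auto
  qed
  moreover have "y \<le> Sup ?S" if "y \<in> ?S" for y
    using cSup_upper[OF that ba] .
  ultimately have "{0..Sup ?S} = ?S"
    unfolding set_eq_iff atLeastAtMost_iff by blast
  then show ?thesis using l by (simp add: cut_deviation_def)
qed

lemma confidence_set_eq:
  assumes p: "\<And>j. component_possibility (c $ j) (dl $ j) (du $ j) (p j)"
    and q: "deviation_possibility D q" and d: "\<And>a. 0 \<le> \<delta> a"
    and l: "0 \<le> \<theta>" "\<theta> \<le> 1"
  shows "confidence_set c dl du D p q \<delta> \<theta> =
    {a. (\<forall>j. cut_lower c dl p \<theta> $ j \<le> a $ j \<and> a $ j \<le> cut_upper c du p \<theta> $ j) \<and>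
        \<delta> a \<le> cut_deviation D q \<theta>}"
proof (cases "\<theta> = 0")
  case True
  then show ?thesis
    by (simp add: confidence_set_def scenario_set_def cut_lower_def cut_upper_def cut_deviation_def)
next
  case False
  with l have l': "0 < \<theta>" by simp
  have "(\<theta> \<le> p j y) = (cut_lower c dl p \<theta> $ j \<le> y \<and> y \<le> cut_upper c du p \<theta> $ j)" for j y
    using component_cut[of c j dl du p, OF p l' l(2)] by (auto simp: set_eq_iff)
  moreover have "(\<theta> \<le> q (\<delta> a)) = (\<delta> a \<le> cut_deviation D q \<theta>)" for a
    using deviation_cut[OF q l' l(2)] d[of a] by (auto simp: set_eq_iff)
  ultimately show ?thesis
    using False by (auto simp: confidence_set_def joint_possibility_def)
qed

end

theory Submission
  imports Defs
begin

text \<open>The confidence sets are nested boxes intersected with \<open>\<ell>\<^sub>1\<close>-balls.  Maximising \<open>a \<bullet> x\<close> over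
  one of them is a fractional knapsack problem, so the greedy solution gives a maximiser together with
  an optimal solution of the dual program.  A single distribution is the worst case for all \<open>t\<close> at
  once: mass \<open>1 / l\<close> on a maximiser over each of the confidence sets number \<open>0, \<dots>, l - 1\<close>.  Hence
  no minimax theorem is needed.  For this distribution the infimum in CVaR is attained at some \<open>t\<close>,
  and the differences of the excesses \<open>max 0 (s\<^sub>i - t)\<close> over the maximal values \<open>s\<^sub>i\<close> provide the
  multipliers \<open>v\<^sub>i\<close>.  Conversely, a solution of the linear system dominates \<open>max 0 (a \<bullet> x - t)\<close>
  pointwise by a combination of indicator functions of the confidence sets, which is then integrated.\<close>

section \<open>Linear maximisation over a box cut by an l1-ball\<close>

text \<open>Greedy filling: items of value above a threshold \<open>g\<close> are taken fully, ties
  at \<open>g\<close> by a common fraction, the rest not at all. The threshold is the dual price of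
  capacity, and equality is complementary slackness: either \<open>g = 0\<close> or the capacity
  \<open>d\<close> is used up.\<close>

lemma fractional_knapsack_duality:
  fixes m y :: "'a \<Rightarrow> real"
  assumes A: "finite A" and m: "\<And>j. j \<in> A \<Longrightarrow> 0 \<le> m j" and d: "0 \<le> d"
  obtains u g where "0 \<le> g" "\<And>j. j \<in> A \<Longrightarrow> 0 \<le> u j \<and> u j \<le> m j" "sum u A \<le> d"
    "(\<Sum>j\<in>A. y j * u j) = (\<Sum>j\<in>A. m j * max 0 (y j - g)) + d * g"
proof -
  define above where "above g = (\<Sum>j | j \<in> A \<and> g < y j. m j)" for g
  \<comment> \<open>The price \<open>g\<close> will be the least candidate for which all items
    strictly above it fit into \<open>d\<close>. The candidate 0 covers the case of spare capacity
    and lies below any positive \<open>g\<close>.\<close>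
  define B where "B = insert 0 (y ` A) \<inter> {0..}"
  define G where "G = {g \<in> B. above g \<le> d}"
  have finB: "finite B" and finG: "finite G"
    using A by (auto simp: B_def G_def)
  have "B \<noteq> {}" by (auto simp: B_def)
  have "{j. j \<in> A \<and> Max B < y j} = {}"
  proof -
    have "y j \<le> Max B" if "j \<in> A" for j
    proof (cases "0 \<le> y j")
      case True
      with that show ?thesis using finB by (intro Max_ge) (auto simp: B_def)
    next
      case False
      have "0 \<le> Max B" using finB by (intro Max_ge) (auto simp: B_def)
      with False show ?thesis by linarith
    qed
    then show ?thesis by force
  qed
  then have "above (Max B) = 0" by (simp only: above_def sum.empty)
  then have "Max B \<in> G"
    using d Max_in[OF finB \<open>B \<noteq> {}\<close>] by (simp add: G_def)
  define g where "g = Min G"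
  have gG: "g \<in> G" using Min_in[OF finG] \<open>Max B \<in> G\<close> by (auto simp: g_def)
  then have g0: "0 \<le> g" and le: "above g \<le> d" by (auto simp: G_def B_def)
  define K where "K = (\<Sum>j | j \<in> A \<and> y j = g. m j)"
  have K0: "0 \<le> K" unfolding K_def by (rule sum_nonneg) (use m in auto)
  \<comment> \<open>The next smaller candidate \<open>h\<close> overflows by minimality of
    \<open>g\<close>. No value lies strictly between \<open>h\<close> and \<open>g\<close>, so
    passing to \<open>h\<close> adds exactly the ties, of total weight \<open>K\<close>.\<close>
  have ge: "d \<le> above g + K" if "0 < g"
  proof -
    let ?H = "{h \<in> B. h < g}"
    have ne: "?H \<noteq> {}" using that by (auto simp: B_def)
    have fin: "finite ?H" using finB by simp
    define h where "h = Max ?H"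
    have hH: "h \<in> ?H" unfolding h_def by (rule Max_in[OF fin ne])
    have "h \<notin> G" using hH Min_le[OF finG, of h] by (auto simp: g_def)
    with hH have "d < above h" by (auto simp: G_def)
    moreover have "{j. j \<in> A \<and> h < y j} = {j. j \<in> A \<and> g < y j} \<union> {j. j \<in> A \<and> y j = g}"
    proof -
      have "g \<le> y j" if "j \<in> A" "h < y j" for j
      proof (rule ccontr)
        assume "\<not> g \<le> y j"
        with that hH have "y j \<in> ?H" by (auto simp: B_def)
        then have "y j \<le> h" unfolding h_def using fin by (intro Max_ge) auto
        with that show False by simp
      qed
      with hH show ?thesis by force
    qed
    then have "above h = above g + K"
      unfolding above_def K_def using A by (simp add: sum.union_disjoint Int_def)
    ultimately show ?thesis by simp
  qed
  define \<theta> where "\<theta> = (if g = 0 \<or> K = 0 then 0 else (d - above g) / K)"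
  have \<theta>: "0 \<le> \<theta>" "\<theta> \<le> 1" and \<theta>g: "0 < g \<Longrightarrow> above g + \<theta> * K = d"
    using le ge K0 g0 by (auto simp: \<theta>_def divide_simps)
  have \<theta>le: "above g + \<theta> * K \<le> d"
    using \<theta>g le g0 by (cases "g = 0") (auto simp: \<theta>_def)
  define u where "u j = (if g < y j then m j else 0) + (if y j = g then \<theta> * m j else 0)" for j
  have sumu: "sum u A = above g + \<theta> * K"
    unfolding u_def sum.distrib above_def K_def sum_distrib_left
    using A by (simp add: sum.inter_filter)
  have "y j * u j = m j * max 0 (y j - g) + g * u j" for j
    by (auto simp: u_def algebra_simps max_def)
  then have "(\<Sum>j\<in>A. y j * u j) = (\<Sum>j\<in>A. m j * max 0 (y j - g)) + g * sum u A"
    by (simp add: sum.distrib sum_distrib_left)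
  moreover have "g * sum u A = d * g" using \<theta>g g0 sumu by (cases "g = 0") auto
  moreover have "0 \<le> u j \<and> u j \<le> m j" if "j \<in> A" for j
    using m[OF that] \<theta> by (auto simp: u_def mult_left_le_one_le)
  ultimately show ?thesis using g0 \<theta>le sumu by (intro that[of g u]) auto
qed

definition l1_box :: "real^'n \<Rightarrow> real^'n \<Rightarrow> real^'n \<Rightarrow> real \<Rightarrow> (real^'n) set" where
  "l1_box c lo up r = {a. (\<forall>j. lo $ j \<le> a $ j \<and> a $ j \<le> up $ j) \<and> l1_deviation c a \<le> r}"

text \<open>Coordinatewise, \<open>\<alpha>\<close> and \<open>\<beta>\<close> price the box bounds,
  and \<open>\<phi> - \<xi>\<close> is the part of \<open>x\<close> charged to the distance from
  \<open>c\<close>. It is at most \<open>\<gamma>\<close> in absolute value, so the summed distances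
  cost at most \<open>r * \<gamma>\<close>.\<close>

lemma l1_box_weak_duality:
  fixes x :: "real^'n"
  assumes a: "a \<in> l1_box c lo up r"
    and x: "\<And>j. \<alpha> $ j - \<beta> $ j + \<phi> $ j - \<xi> $ j = x $ j"
    and g: "\<And>j. \<gamma> - \<phi> $ j - \<xi> $ j \<ge> 0" "0 \<le> \<gamma>"
    and nn: "\<And>j. \<alpha> $ j \<ge> 0 \<and> \<beta> $ j \<ge> 0 \<and> \<phi> $ j \<ge> 0 \<and> \<xi> $ j \<ge> 0"
  shows "a \<bullet> x \<le> up \<bullet> \<alpha> - lo \<bullet> \<beta> + c \<bullet> (\<phi> - \<xi>) + r * \<gamma>"
proof -
  have "a $ j * x $ j \<le> up $ j * \<alpha> $ j - lo $ j * \<beta> $ j + c $ j * (\<phi> $ j - \<xi> $ j)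
      + \<bar>a $ j - c $ j\<bar> * \<gamma>" for j
  proof -
    have b: "a $ j * \<alpha> $ j \<le> up $ j * \<alpha> $ j" "lo $ j * \<beta> $ j \<le> a $ j * \<beta> $ j"
      using a nn[of j] by (auto simp: l1_box_def mult_right_mono)
    have "(a $ j - c $ j) * (\<phi> $ j - \<xi> $ j) \<le> \<bar>a $ j - c $ j\<bar> * \<bar>\<phi> $ j - \<xi> $ j\<bar>"
      by (metis abs_ge_self abs_mult)
    also have "\<dots> \<le> \<bar>a $ j - c $ j\<bar> * \<gamma>"
      using nn[of j] g(1)[of j] by (intro mult_left_mono) auto
    finally have "a $ j * (\<phi> $ j - \<xi> $ j) \<le> c $ j * (\<phi> $ j - \<xi> $ j) + \<bar>a $ j - c $ j\<bar> * \<gamma>"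
      by (simp add: left_diff_distrib)
    moreover have "a $ j * x $ j = a $ j * \<alpha> $ j - a $ j * \<beta> $ j + a $ j * (\<phi> $ j - \<xi> $ j)"
      by (simp add: x[of j, symmetric] algebra_simps)
    ultimately show ?thesis using b by linarith
  qed
  then have "a \<bullet> x \<le> (\<Sum>j\<in>UNIV. up $ j * \<alpha> $ j - lo $ j * \<beta> $ j + c $ j * (\<phi> $ j - \<xi> $ j)
      + \<bar>a $ j - c $ j\<bar> * \<gamma>)"
    by (simp add: inner_vec_def sum_mono)
  also have "\<dots> = up \<bullet> \<alpha> - lo \<bullet> \<beta> + c \<bullet> (\<phi> - \<xi>) + l1_deviation c a * \<gamma>"
    by (simp add: inner_vec_def sum.distrib sum_subtractf l1_deviation_def sum_distrib_right)
  also have "\<dots> \<le> up \<bullet> \<alpha> - lo \<bullet> \<beta> + c \<bullet> (\<phi> - \<xi>) + r * \<gamma>"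
    using a g(2) by (simp add: l1_box_def mult_right_mono)
  finally show ?thesis .
qed

text \<open>Moving coordinate \<open>j\<close> away from \<open>c\<close> in the direction of the
  sign of \<open>x $ j\<close> gains \<open>\<bar>x $ j\<bar>\<close> per unit; the box limits each
  move and \<open>r\<close> their sum, which is a fractional knapsack. Its price
  \<open>\<gamma>\<close> splits \<open>x\<close>: the part clipped to absolute value
  \<open>\<gamma>\<close> is \<open>\<phi> - \<xi>\<close>, the excess is
  \<open>\<alpha> - \<beta>\<close>.\<close>

lemma l1_box_strong_duality:
  fixes x :: "real^'n"
  assumes c: "c \<in> l1_box c lo up r"
  obtains a \<gamma> \<alpha> \<beta> \<phi> \<xi> where "a \<in> l1_box c lo up r"
    "a \<bullet> x = up \<bullet> \<alpha> - lo \<bullet> \<beta> + c \<bullet> (\<phi> - \<xi>) + r * \<gamma>"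
    "\<And>j. \<alpha> $ j - \<beta> $ j + \<phi> $ j - \<xi> $ j = x $ j"
    "\<And>j. \<gamma> - \<phi> $ j - \<xi> $ j \<ge> 0" "0 \<le> \<gamma>"
    "\<And>j. \<alpha> $ j \<ge> 0 \<and> \<beta> $ j \<ge> 0 \<and> \<phi> $ j \<ge> 0 \<and> \<xi> $ j \<ge> 0"
proof -
  define m where "m j = (if 0 \<le> x $ j then up $ j - c $ j else c $ j - lo $ j)" for j
  have lu: "\<And>j. lo $ j \<le> c $ j" "\<And>j. c $ j \<le> up $ j" and r: "0 \<le> r"
    using c by (auto simp: l1_box_def l1_deviation_def)
  obtain u \<gamma> where \<gamma>: "0 \<le> \<gamma>" and u: "\<And>j. 0 \<le> u j \<and> u j \<le> m j" and su: "sum u UNIV \<le> r"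
    and eq: "(\<Sum>j\<in>UNIV. \<bar>x $ j\<bar> * u j) = (\<Sum>j\<in>UNIV. m j * max 0 (\<bar>x $ j\<bar> - \<gamma>)) + r * \<gamma>"
  proof (rule fractional_knapsack_duality[of UNIV m r "\<lambda>j. \<bar>x $ j\<bar>"])
    show "0 \<le> m j" for j using lu by (simp add: m_def)
  qed (use r in auto)
  define a where "a = (\<chi> j. c $ j + sgn (x $ j) * u j)"
  define \<alpha> where "\<alpha> = (\<chi> j. max 0 (x $ j - \<gamma>))"
  define \<beta> where "\<beta> = (\<chi> j. max 0 (- x $ j - \<gamma>))"
  define \<phi> where "\<phi> = (\<chi> j. min (max 0 (x $ j)) \<gamma>)"
  define \<xi> where "\<xi> = (\<chi> j. min (max 0 (- x $ j)) \<gamma>)"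
  \<comment> \<open>Only an inequality: \<open>sgn 0 = 0\<close> leaves coordinates with
    \<open>x $ j = 0\<close> at \<open>c\<close>, whatever \<open>u j\<close> is.\<close>
  have "l1_deviation c a \<le> sum u UNIV"
    unfolding l1_deviation_def
    by (rule sum_mono) (use u in \<open>auto simp: a_def abs_mult sgn_if\<close>)
  moreover have "lo $ j \<le> a $ j \<and> a $ j \<le> up $ j" for j
    using u[of j] lu[of j] by (auto simp: a_def m_def sgn_if split: if_splits)
  ultimately have aC: "a \<in> l1_box c lo up r" using su by (auto simp: l1_box_def)
  have "a $ j * x $ j = c $ j * x $ j + \<bar>x $ j\<bar> * u j" for j
    by (simp add: a_def algebra_simps abs_sgn)
  then have ax: "a \<bullet> x = c \<bullet> x + (\<Sum>j\<in>UNIV. \<bar>x $ j\<bar> * u j)"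
    by (simp add: inner_vec_def sum.distrib)
  have "up $ j * \<alpha> $ j - lo $ j * \<beta> $ j + c $ j * (\<phi> $ j - \<xi> $ j)
      = c $ j * x $ j + m j * max 0 (\<bar>x $ j\<bar> - \<gamma>)" for j
    using \<gamma> by (auto simp: \<alpha>_def \<beta>_def \<phi>_def \<xi>_def m_def max_def min_def algebra_simps)
  then have "(\<Sum>j\<in>UNIV. up $ j * \<alpha> $ j - lo $ j * \<beta> $ j + c $ j * (\<phi> $ j - \<xi> $ j))
      = c \<bullet> x + (\<Sum>j\<in>UNIV. m j * max 0 (\<bar>x $ j\<bar> - \<gamma>))"
    by (simp add: inner_vec_def sum.distrib)
  then have "a \<bullet> x = up \<bullet> \<alpha> - lo \<bullet> \<beta> + c \<bullet> (\<phi> - \<xi>) + r * \<gamma>"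
    using ax eq by (simp add: inner_vec_def sum.distrib sum_subtractf)
  with aC \<gamma> show ?thesis
    by (intro that[of a \<alpha> \<beta> \<phi> \<xi> \<gamma>])
      (auto simp: \<alpha>_def \<beta>_def \<phi>_def \<xi>_def max_def min_def)
qed

section \<open>Topology and nesting of the confidence sets\<close>

lemma closed_l1_box:
  fixes c :: "real^'n"
  shows "closed (l1_box c lo up r)"
proof -
  have "l1_box c lo up r = (\<Inter>j. {a. lo $ j \<le> a $ j} \<inter> {a. a $ j \<le> up $ j})
      \<inter> {a. l1_deviation c a \<le> r}"
    by (auto simp: l1_box_def)
  moreover have "closed {a::real^'n. l1_deviation c a \<le> r}"
    unfolding l1_deviation_def by (intro closed_Collect_le continuous_intros)
  ultimately show ?thesis
    by (auto intro!: closed_Int closed_INT closed_Collect_le continuous_intros)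
qed

lemma joint_possibility_ge_iff:
  "\<theta> \<le> joint_possibility p q \<delta> a \<longleftrightarrow> \<theta> \<le> q (\<delta> a) \<and> (\<forall>j. \<theta> \<le> p j (a $ j))"
  by (auto simp: joint_possibility_def)

text \<open>The case with content is the passage from a positive level to level 0, where the
  definition changes: positive possibility forces each component and the deviation into its
  support.\<close>

lemma confidence_set_antimono:
  assumes p: "\<And>j. component_possibility (c $ j) (dl $ j) (du $ j) (p j)"
    and q: "deviation_possibility D q" and "0 \<le> \<theta>" "\<theta> \<le> \<theta>'"
  shows "confidence_set c dl du D p q \<delta> \<theta>' \<subseteq> confidence_set c dl du D p q \<delta> \<theta>"
proof (cases "\<theta> = 0 \<and> \<theta>' \<noteq> 0")
  case True
  have "a \<in> scenario_set c dl du D \<delta>" if "\<theta>' \<le> joint_possibility p q \<delta> a" for a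
  proof -
    have "0 < p j (a $ j)" for j
      using that True assms(4) by (smt (verit) joint_possibility_ge_iff)
    then have "a $ j \<in> {c $ j - dl $ j..c $ j + du $ j}" for j
      using p[of j] unfolding component_possibility_def by (metis less_irrefl)
    moreover have "0 < q (\<delta> a)"
      using that True assms(4) by (smt (verit) joint_possibility_ge_iff)
    then have "\<delta> a \<le> D"
      using q unfolding deviation_possibility_def by (metis less_irrefl linear)
    ultimately show ?thesis by (auto simp: scenario_set_def)
  qed
  with True show ?thesis by (auto simp: confidence_set_def)
next
  case False
  with assms(3,4) show ?thesis by (auto simp: confidence_set_def)
qed

lemma nominal_in_confidence_set:
  assumes "\<And>j. component_possibility (c $ j) (dl $ j) (du $ j) (p j)"
    and "deviation_possibility D q" and "\<delta> c = 0" and "0 \<le> \<theta>" "\<theta> \<le> 1"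
  shows "c \<in> confidence_set c dl du D p q \<delta> \<theta>"
proof -
  have "c \<in> confidence_set c dl du D p q \<delta> 1"
    using assms(1-3)
    by (simp add: confidence_set_def joint_possibility_ge_iff component_possibility_def
        deviation_possibility_def)
  then show ?thesis using confidence_set_antimono[OF assms(1,2,4,5)] by blast
qed

section \<open>Sums over the levels and the CVaR objective of a uniform distribution\<close>

text \<open>With the decrements of \<open>f\<close> as multipliers, the objective of the linear
  system becomes a mean. The value \<open>f l\<close> drops out because
  \<open>level l l = 1\<close>.\<close>

lemma summation_by_parts_levels:
  assumes "0 < l"
  shows "f 0 + (\<Sum>i\<le>l. (level l i - 1) * (if i = 0 then 0 else f (i - 1) - f i))
    = (\<Sum>i<l. f i) / real l"
proof -
  \<comment> \<open>Stopping at an arbitrary \<open>k\<close> leaves a boundary term, which carries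
    the induction and vanishes at \<open>k = l\<close>.\<close>
  have "real l * f 0 + (\<Sum>i\<le>k. (real i - real l) * (if i = 0 then 0 else f (i - 1) - f i))
      = (\<Sum>i<k. f i) + (real l - real k) * f k" for k
    by (induction k) (auto simp: algebra_simps)
  from this[of l]
  have *: "real l * f 0 + (\<Sum>i\<le>l. (real i - real l) * (if i = 0 then 0 else f (i - 1) - f i))
      = (\<Sum>i<l. f i)" by simp
  have "(level l i - 1) * z = (real i - real l) * z / real l" for i z
    using assms by (simp add: level_def field_simps)
  then have "(\<Sum>i\<le>l. (level l i - 1) * (if i = 0 then 0 else f (i - 1) - f i))
      = (\<Sum>i\<le>l. (real i - real l) * (if i = 0 then 0 else f (i - 1) - f i)) / real l"
    by (simp add: sum_divide_distrib)
  then show ?thesis using assms * by (simp add: field_simps)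
qed

text \<open>Left of all \<open>s i\<close> the slope of \<open>g\<close> is
  \<open>1 - 1 / (1 - \<epsilon>) \<le> 0\<close>, right of them it is 1, so a minimum over the
  compact interval between is global.\<close>

lemma expected_excess_minimum_attained:
  fixes s :: "nat \<Rightarrow> real"
  assumes e: "0 \<le> \<epsilon>" "\<epsilon> < 1" and l: "0 < l"
  defines "g \<equiv> \<lambda>t. t + 1 / (1 - \<epsilon>) * ((\<Sum>i<l. max 0 (s i - t)) / real l)"
  obtains t0 where "\<And>t. g t0 \<le> g t"
proof -
  let ?S = "s ` {..<l}"
  have fin: "finite ?S" "?S \<noteq> {}" using l by auto
  define A B where "A = Min ?S" and "B = Max ?S"
  have s: "A \<le> s i" "s i \<le> B" if "i < l" for i
    using that fin by (auto simp: A_def B_def)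
  have "A \<le> B" using s[OF l] by linarith
  moreover have "continuous_on {A..B} g" unfolding g_def
    by (intro continuous_intros) (use l in auto)
  ultimately obtain t0 where t0: "t0 \<in> {A..B}" "\<And>t. t \<in> {A..B} \<Longrightarrow> g t0 \<le> g t"
    using continuous_attains_inf[of "{A..B}" g] by auto
  have "g t0 \<le> g t" for t
  proof -
    consider "t < A" | "t \<in> {A..B}" | "B < t" by force
    then show ?thesis
    proof cases
      case 1
      have eq: "g z = z + 1 / (1 - \<epsilon>) * ((\<Sum>i<l. s i) / real l - z)" if "z \<le> A" for z
      proof -
        have "(\<Sum>i<l. max 0 (s i - z)) = (\<Sum>i<l. s i - z)"
          by (rule sum.cong) (use s that in \<open>force simp: max_def\<close>)+
        also have "\<dots> / real l = (\<Sum>i<l. s i) / real l - z"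
          using l by (simp add: sum_subtractf field_simps)
        finally show ?thesis unfolding g_def by (simp only:)
      qed
      have "g t - g A = (A - t) * (1 / (1 - \<epsilon>) - 1)"
        using 1 by (simp add: eq algebra_simps diff_divide_distrib)
      also have "\<dots> \<ge> 0" using 1 e by (intro mult_nonneg_nonneg) (auto simp: field_simps)
      finally show ?thesis using t0(2)[of A] \<open>A \<le> B\<close> by simp
    next
      case 2
      then show ?thesis by (rule t0)
    next
      case 3
      have eq: "g z = z" if "B \<le> z" for z
      proof -
        have "(\<Sum>i<l. max 0 (s i - z)) = 0"
          by (rule sum.neutral) (use s that in \<open>force simp: max_def\<close>)
        then show ?thesis by (simp add: g_def)
      qed
      show ?thesis using t0(2)[of B] \<open>A \<le> B\<close> 3 eq[of B] eq[of t] by simp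
    qed
  qed
  then show ?thesis by (rule that)
qed

section \<open>Upper bound for expectations and the extremal distribution\<close>

text \<open>At a point whose deepest set is \<open>C k\<close>, the function \<open>h\<close> below
  equals \<open>w - (\<Sum>j\<le>k. v j)\<close>, hence dominates \<open>f\<close>. Integrating
  \<open>h\<close> turns indicators into probabilities, whose lower bounds enter with weights
  \<open>v i \<ge> 0\<close>.\<close>

lemma (in prob_space) expectation_le_nested_weights:
  fixes v :: "nat \<Rightarrow> real" and C :: "nat \<Rightarrow> 'a set"
  assumes sets: "\<And>i. i \<le> l \<Longrightarrow> C i \<in> events"
    and nested: "\<And>i k. i \<le> k \<Longrightarrow> k \<le> l \<Longrightarrow> C k \<subseteq> C i" and C0: "C 0 = space M"
    and v: "\<And>i. i \<le> l \<Longrightarrow> 0 \<le> v i"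
    and prob: "\<And>i. i \<le> l \<Longrightarrow> prob (C i) \<ge> 1 - r i"
    and w: "\<And>i. i \<le> l \<Longrightarrow> 0 \<le> w - (\<Sum>j\<le>i. v j)"
    and f: "\<And>i a. i \<le> l \<Longrightarrow> a \<in> C i \<Longrightarrow> f a \<le> w - (\<Sum>j\<le>i. v j)"
  shows "expectation f \<le> w + (\<Sum>i\<le>l. (r i - 1) * v i)"
proof -
  define h where "h a = w - (\<Sum>i\<le>l. v i * indicator (C i) a)" for a
  have int: "integrable M (\<lambda>a. v i * indicator (C i) a)" if "i \<le> l" for i
    using sets[OF that] by (auto simp: emeasure_eq_measure)
  have ih: "integrable M h"
    unfolding h_def using int
    by (intro Bochner_Integration.integrable_diff Bochner_Integration.integrable_sum) auto
  have bound: "0 \<le> h a \<and> f a \<le> h a" if a: "a \<in> space M" for a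
  proof -
    let ?I = "{i. i \<le> l \<and> a \<in> C i}"
    have fin: "finite ?I" and ne: "?I \<noteq> {}" using a C0 by auto
    define k where "k = Max ?I"
    have k: "k \<le> l" "a \<in> C k" using Max_in[OF fin ne] by (auto simp: k_def)
    have "a \<in> C i \<longleftrightarrow> i \<le> k" if "i \<le> l" for i
      using that nested[of i k] k Max_ge[OF fin, of i] by (auto simp: k_def)
    then have "(\<Sum>i\<le>l. v i * indicator (C i) a) = (\<Sum>i\<le>l. if i \<le> k then v i else 0)"
      by (intro sum.cong) (auto simp: indicator_def)
    also have "\<dots> = (\<Sum>i\<le>k. v i)"
      using k(1) by (intro sum.mono_neutral_cong_right) auto
    finally show ?thesis using w[OF k(1)] f[OF k] by (simp add: h_def)
  qed
  \<comment> \<open>If \<open>f\<close> is not integrable, its Bochner integral is 0;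
    \<open>0 \<le> h a\<close> covers that case.\<close>
  have "expectation f \<le> expectation h"
    using ih bound by (intro integral_mono') auto
  also have "\<dots> = expectation (\<lambda>_. w) - expectation (\<lambda>a. \<Sum>i\<le>l. v i * indicator (C i) a)"
    unfolding h_def using int
    by (intro Bochner_Integration.integral_diff Bochner_Integration.integrable_sum) auto
  also have "expectation (\<lambda>a. \<Sum>i\<le>l. v i * indicator (C i) a)
      = (\<Sum>i\<le>l. expectation (\<lambda>a. v i * indicator (C i) a))"
    using int by (intro Bochner_Integration.integral_sum) auto
  also have "expectation (\<lambda>_. w) - \<dots> = w - (\<Sum>i\<le>l. v i * prob (C i))"
    using sets by (simp add: prob_space)
  also have "\<dots> \<le> w - (\<Sum>i\<le>l. v i * (1 - r i))"
    using v prob by (auto intro!: sum_mono mult_left_mono)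
  also have "\<dots> = w + (\<Sum>i\<le>l. (r i - 1) * v i)"
    by (simp add: algebra_simps sum_subtractf)
  finally show ?thesis .
qed

text \<open>Each \<open>a k\<close> gets weight \<open>1 / l\<close>. By nesting, \<open>C i\<close>
  contains the \<open>l - i\<close> points with index from \<open>i\<close> to \<open>l - 1\<close>,
  which is the required mass; for \<open>i = l\<close> the requirement is void.\<close>

lemma uniform_in_ambiguity_set:
  fixes a :: "nat \<Rightarrow> real^'n" and C :: "nat \<Rightarrow> (real^'n) set"
  assumes C_def: "C = (\<lambda>i. confidence_set c dl du D p q \<delta> (level l i))"
    and l: "0 < l" and a: "\<And>k. k < l \<Longrightarrow> a k \<in> C k"
    and nested: "\<And>i k. i \<le> k \<Longrightarrow> k \<le> l \<Longrightarrow> C k \<subseteq> C i"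
    and borel: "\<And>i. i \<le> l \<Longrightarrow> C i \<in> sets borel"
  obtains P where "P \<in> ambiguity_set c dl du D p q \<delta> l"
    "\<And>f::real^'n \<Rightarrow> real. f \<in> borel_measurable borel \<Longrightarrow> (LINT z|P. f z) = (\<Sum>k<l. f (a k)) / real l"
proof -
  let ?U = "scenario_set c dl du D \<delta>"
  have U: "C 0 = ?U" by (simp add: C_def confidence_set_def level_def)
  \<comment> \<open>The uniform distribution lives on all of \<open>nat\<close>, so the null indices
    from \<open>l\<close> on must also be sent into the scenario set.\<close>
  define a' where "a' k = a (if k < l then k else 0)" for k
  have a': "a' k \<in> ?U" for k
    using a[of "if k < l then k else 0"] nested[of 0 "if k < l then k else 0"] l
    by (auto simp: a'_def simp flip: U)
  let ?Q = "measure_pmf (pmf_of_set {..<l})"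
  define P where "P = distr ?Q (restrict_space borel ?U) a'"
  have ne: "{..<l} \<noteq> {}" using l by auto
  have meas: "a' \<in> measurable ?Q (restrict_space borel ?U)"
    using a' by (auto intro!: measurable_restrict_space2 simp: space_restrict_space)
  have "prob_space P" unfolding P_def
    by (intro prob_space.prob_space_distr prob_space_measure_pmf meas)
  moreover have "sets P = sets (restrict_space borel ?U)" by (simp add: P_def)
  moreover have "measure P (C i) \<ge> 1 - level l i" if i: "i \<le> l" for i
  proof -
    have "C i \<in> sets (restrict_space borel ?U)"
      using borel[OF i] borel[of 0] nested[of 0 i] i U by (subst sets_restrict_space_iff) auto
    then have "measure P (C i) = real (card ({..<l} \<inter> a' -` C i)) / real l"
      using ne unfolding P_def
      by (subst measure_distr[OF meas]) (auto simp: measure_pmf_of_set)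
    moreover have "{i..<l} \<subseteq> {..<l} \<inter> a' -` C i"
      using a nested by (fastforce simp: a'_def)
    then have "card {i..<l} \<le> card ({..<l} \<inter> a' -` C i)" by (intro card_mono) auto
    then have "real l - real i \<le> real (card ({..<l} \<inter> a' -` C i))" using i by simp
    ultimately show ?thesis using l by (simp add: level_def field_simps)
  qed
  ultimately have "P \<in> ambiguity_set c dl du D p q \<delta> l"
    by (simp add: ambiguity_set_def C_def)
  moreover have "(LINT z|P. f z) = (\<Sum>k<l. f (a k)) / real l"
    if f: "f \<in> borel_measurable borel" for f :: "real^'n \<Rightarrow> real"
  proof -
    have "(LINT z|P. f z) = (LINT k|?Q. f (a' k))"
      unfolding P_def using meas f by (intro integral_distr) (auto intro: measurable_restrict_space1)
    also have "\<dots> = (\<Sum>k<l. f (a' k)) / real l"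
      using ne by (simp add: integral_pmf_of_set)
    finally show ?thesis by (simp add: a'_def)
  qed
  ultimately show ?thesis by (rule that)
qed

section \<open>Equivalence of the CVaR constraint and the linear system\<close>

theorem corollary2:
  fixes X :: "(real^'n) set" and b \<epsilon> :: real and l :: nat
    and c dl du :: "real^'n" and D :: real
    and p :: "'n \<Rightarrow> real \<Rightarrow> real" and q :: "real \<Rightarrow> real"
  assumes "0 \<le> \<epsilon>" "\<epsilon> < 1" and "0 < l"
    and "\<And>j. 0 < dl $ j" and "\<And>j. 0 < du $ j" and "0 < D"
    and "\<And>j. component_possibility (c $ j) (dl $ j) (du $ j) (p j)"
    and "deviation_possibility D q"
  shows "\<forall>x\<in>X.
    (SUP P\<in>ambiguity_set c dl du D p q (l1_deviation c) l. CVaR \<epsilon> P (\<lambda>a. a \<bullet> x)) \<le> ereal b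
    \<longleftrightarrow>
    (\<exists>(w::real) (t::real) (v::nat \<Rightarrow> real) (\<gamma>::nat \<Rightarrow> real)
       (\<alpha>::nat \<Rightarrow> real^'n) (\<beta>::nat \<Rightarrow> real^'n) (\<phi>::nat \<Rightarrow> real^'n) (\<xi>::nat \<Rightarrow> real^'n).
       w + (\<Sum>i\<le>l. (level l i - 1) * v i) \<le> (b - t) * (1 - \<epsilon>) \<and>
       (\<forall>i\<le>l. w - (\<Sum>j\<le>i. v j) \<ge> 0) \<and>
       (\<forall>i\<le>l. w - (\<Sum>j\<le>i. v j) + t \<ge>
          cut_upper c du p (level l i) \<bullet> \<alpha> i - cut_lower c dl p (level l i) \<bullet> \<beta> i
          + c \<bullet> (\<phi> i - \<xi> i) + cut_deviation D q (level l i) * \<gamma> i) \<and>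
       (\<forall>i\<le>l. \<forall>j. \<alpha> i $ j - \<beta> i $ j + \<phi> i $ j - \<xi> i $ j = x $ j) \<and>
       (\<forall>i\<le>l. \<forall>j. \<gamma> i - \<phi> i $ j - \<xi> i $ j \<ge> 0) \<and>
       (\<forall>i\<le>l. \<forall>j. \<alpha> i $ j \<ge> 0 \<and> \<beta> i $ j \<ge> 0 \<and> \<phi> i $ j \<ge> 0 \<and> \<xi> i $ j \<ge> 0) \<and>
       (\<forall>i\<le>l. v i \<ge> 0 \<and> \<gamma> i \<ge> 0))"
proof
  let "\<forall>x\<in>X. ?sup x \<le> _ \<longleftrightarrow> ?sys x" = ?thesis
  fix x assume "x \<in> X"
  note e = assms(1,2) and l = assms(3) and p = assms(7) and q = assms(8)
  let ?\<delta> = "l1_deviation c"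
  define C where "C i = confidence_set c dl du D p q ?\<delta> (level l i)" for i
  let ?lo = "\<lambda>i. cut_lower c dl p (level l i)"
  let ?up = "\<lambda>i. cut_upper c du p (level l i)"
  let ?r = "\<lambda>i. cut_deviation D q (level l i)"
  have lev: "0 \<le> level l i" "level l i \<le> 1" if "i \<le> l" for i
    using that l by (auto simp: level_def)
  have C: "C i = l1_box c (?lo i) (?up i) (?r i)" if "i \<le> l" for i
    unfolding C_def l1_box_def
    by (rule confidence_set_eq[OF p q _ lev[OF that]]) (simp add: l1_deviation_def sum_nonneg)
  have nested: "C k \<subseteq> C i" if "i \<le> k" "k \<le> l" for i k
    unfolding C_def by (rule confidence_set_antimono[OF p q])
      (use that l in \<open>auto simp: level_def divide_right_mono\<close>)
  have borel: "C i \<in> sets borel" if "i \<le> l" for i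
    using C[OF that] closed_l1_box by (metis borel_closed)
  have cC: "c \<in> C i" if "i \<le> l" for i
    unfolding C_def by (rule nominal_in_confidence_set[OF p q _ lev[OF that]])
      (simp add: l1_deviation_def)
  show "?sup x \<le> ereal b \<longleftrightarrow> ?sys x"
  proof
    assume sup: "?sup x \<le> ereal b"
    have "\<exists>a \<gamma> \<alpha> \<beta> \<phi> \<xi>. i \<le> l \<longrightarrow> a \<in> C i \<and>
        a \<bullet> x = ?up i \<bullet> \<alpha> - ?lo i \<bullet> \<beta> + c \<bullet> (\<phi> - \<xi>) + ?r i * \<gamma> \<and>
        (\<forall>j. \<alpha> $ j - \<beta> $ j + \<phi> $ j - \<xi> $ j = x $ j) \<and>
        (\<forall>j. \<gamma> - \<phi> $ j - \<xi> $ j \<ge> 0) \<and> 0 \<le> \<gamma> \<and>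
        (\<forall>j. \<alpha> $ j \<ge> 0 \<and> \<beta> $ j \<ge> 0 \<and> \<phi> $ j \<ge> 0 \<and> \<xi> $ j \<ge> 0)" for i
    proof (cases "i \<le> l")
      case True
      from cC[OF True] show ?thesis unfolding C[OF True]
        by (rule l1_box_strong_duality[where x = x]) blast
    qed simp
    then obtain a \<gamma> \<alpha> \<beta> \<phi> \<xi> where dual: "\<And>i. i \<le> l \<Longrightarrow> a i \<in> C i \<and>
        a i \<bullet> x = ?up i \<bullet> \<alpha> i - ?lo i \<bullet> \<beta> i + c \<bullet> (\<phi> i - \<xi> i) + ?r i * \<gamma> i \<and>
        (\<forall>j. \<alpha> i $ j - \<beta> i $ j + \<phi> i $ j - \<xi> i $ j = x $ j) \<and>
        (\<forall>j. \<gamma> i - \<phi> i $ j - \<xi> i $ j \<ge> 0) \<and> 0 \<le> \<gamma> i \<and>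
        (\<forall>j. \<alpha> i $ j \<ge> 0 \<and> \<beta> i $ j \<ge> 0 \<and> \<phi> i $ j \<ge> 0 \<and> \<xi> i $ j \<ge> 0)"
      by metis
    \<comment> \<open>Weak duality, applied to the dual solution of equal value, certifies that
      \<open>a i\<close> is a maximiser over \<open>C i\<close>.\<close>
    have max: "z \<bullet> x \<le> a i \<bullet> x" if "i \<le> l" "z \<in> C i" for i z
      using l1_box_weak_duality[of z c "?lo i" "?up i" "?r i" "\<alpha> i" "\<beta> i" "\<phi> i" "\<xi> i" x "\<gamma> i"]
        dual[OF that(1)] that C by auto
    define s where "s i = a i \<bullet> x" for i
    define g where "g t = t + 1 / (1 - \<epsilon>) * ((\<Sum>i<l. max 0 (s i - t)) / real l)" for t
    obtain P where P: "P \<in> ambiguity_set c dl du D p q ?\<delta> l"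
      and int: "\<And>f::real^'n \<Rightarrow> real. f \<in> borel_measurable borel \<Longrightarrow>
        (LINT z|P. f z) = (\<Sum>k<l. f (a k)) / real l"
    proof (rule uniform_in_ambiguity_set[of C c dl du D p q ?\<delta> l a])
      show "C = (\<lambda>i. confidence_set c dl du D p q ?\<delta> (level l i))"
        by (simp add: C_def fun_eq_iff)
    qed (use l dual nested borel in auto)
    have "CVaR \<epsilon> P (\<lambda>a. a \<bullet> x) = (INF t. ereal (g t))"
      by (simp add: CVaR_def int g_def s_def)
    \<comment> \<open>The minimiser of \<open>g\<close> becomes the variable \<open>t\<close> of the
      system; attainment gives \<open>g t \<le> b\<close> for a single \<open>t\<close>.\<close>
    moreover obtain t where t: "\<And>t'. g t \<le> g t'"
      using expected_excess_minimum_attained[OF e l, of s] unfolding g_def by blast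
    then have "ereal (g t) \<le> (INF t. ereal (g t))" by (intro INF_greatest) simp
    moreover have "CVaR \<epsilon> P (\<lambda>a. a \<bullet> x) \<le> ereal b"
      using sup P by (meson SUP_upper order_trans)
    ultimately have gb: "g t \<le> b" by (metis ereal_less_eq(3) order_trans)
    define f where "f i = max 0 (s i - t)" for i
    \<comment> \<open>With \<open>w = f 0\<close> and \<open>v 0 = 0\<close> the partial sums
      telescope to \<open>f i\<close>, so the constraints reduce to \<open>0 \<le> f i\<close> and
      \<open>s i \<le> f i + t\<close>. Nesting makes \<open>s\<close> decreasing, hence
      \<open>v\<close> nonnegative.\<close>
    define v where "v i = (if i = 0 then 0 else f (i - 1) - f i)" for i
    have v: "0 \<le> v i" if "i \<le> l" for i
    proof (cases i)
      case (Suc k)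
      with that have "s i \<le> s k" unfolding s_def
        using dual[of i] nested[of k i] by (intro max) auto
      with Suc show ?thesis by (simp add: v_def f_def)
    qed (simp add: v_def)
    have f: "f 0 - (\<Sum>j\<le>i. v j) = f i" for i
      by (induction i) (auto simp: v_def)
    have "f 0 + (\<Sum>i\<le>l. (level l i - 1) * v i) = (\<Sum>i<l. f i) / real l"
      unfolding v_def by (rule summation_by_parts_levels[OF l])
    also have "\<dots> = (g t - t) * (1 - \<epsilon>)" using e by (simp add: g_def f_def)
    also have "\<dots> \<le> (b - t) * (1 - \<epsilon>)" using gb e by (intro mult_right_mono) auto
    finally have obj: "f 0 + (\<Sum>i\<le>l. (level l i - 1) * v i) \<le> (b - t) * (1 - \<epsilon>)" .
    have f0: "0 \<le> f i" for i by (simp add: f_def)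
    have fs: "?up i \<bullet> \<alpha> i - ?lo i \<bullet> \<beta> i + c \<bullet> (\<phi> i - \<xi> i) + ?r i * \<gamma> i \<le> f i + t"
      if "i \<le> l" for i
      using dual[OF that] by (simp add: f_def s_def)
    show "?sys x"
      by (rule exI[of _ "f 0"], rule exI[of _ t], rule exI[of _ v], rule exI[of _ \<gamma>],
          rule exI[of _ \<alpha>], rule exI[of _ \<beta>], rule exI[of _ \<phi>], rule exI[of _ \<xi>])
        (use obj v f0 fs dual in \<open>simp add: f\<close>)
  next
    assume "?sys x"
    then obtain w t v \<gamma> \<alpha> \<beta> \<phi> \<xi> where
      obj: "w + (\<Sum>i\<le>l. (level l i - 1) * v i) \<le> (b - t) * (1 - \<epsilon>)"
      and w: "\<And>i. i \<le> l \<Longrightarrow> w - (\<Sum>j\<le>i. v j) \<ge> 0"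
      and wt: "\<And>i. i \<le> l \<Longrightarrow> w - (\<Sum>j\<le>i. v j) + t \<ge>
        ?up i \<bullet> \<alpha> i - ?lo i \<bullet> \<beta> i + c \<bullet> (\<phi> i - \<xi> i) + ?r i * \<gamma> i"
      and x: "\<And>i j. i \<le> l \<Longrightarrow> \<alpha> i $ j - \<beta> i $ j + \<phi> i $ j - \<xi> i $ j = x $ j"
      and \<gamma>: "\<And>i j. i \<le> l \<Longrightarrow> \<gamma> i - \<phi> i $ j - \<xi> i $ j \<ge> 0"
      and nn: "\<And>i j. i \<le> l \<Longrightarrow>
        \<alpha> i $ j \<ge> 0 \<and> \<beta> i $ j \<ge> 0 \<and> \<phi> i $ j \<ge> 0 \<and> \<xi> i $ j \<ge> 0"
      and v\<gamma>: "\<And>i. i \<le> l \<Longrightarrow> v i \<ge> 0 \<and> \<gamma> i \<ge> 0"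
    proof (elim exE conjE, goal_cases)
      case (1 w t v \<gamma> \<alpha> \<beta> \<phi> \<xi>)
      show ?case by (rule that[of w v t \<alpha> \<beta> \<phi> \<xi> \<gamma>]) (use 1(2-) in simp_all)
    qed
    show "?sup x \<le> ereal b"
    proof (rule SUP_least)
      fix P assume P: "P \<in> ambiguity_set c dl du D p q ?\<delta> l"
      then interpret prob_space P by (simp add: ambiguity_set_def)
      have setsP: "sets P = sets (restrict_space borel (C 0))"
        using P by (simp add: ambiguity_set_def C_def confidence_set_def level_def)
      then have spaceP: "C 0 = space P"
        using sets_eq_imp_space_eq[OF setsP] by (simp add: space_restrict_space)
      have "expectation (\<lambda>a. max 0 (a \<bullet> x - t)) \<le> w + (\<Sum>i\<le>l. (level l i - 1) * v i)"
      proof (rule expectation_le_nested_weights[where C = C])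
        show "C i \<in> events" if "i \<le> l" for i
          unfolding setsP using borel[OF that] borel[of 0] nested[of 0 i] that
          by (subst sets_restrict_space_iff) auto
        show "prob (C i) \<ge> 1 - level l i" if "i \<le> l" for i
          using P that by (simp add: ambiguity_set_def C_def)
        \<comment> \<open>The two branches of the maximum match two constraint families: 0 is
          bounded by \<open>w\<close>, and \<open>a \<bullet> x - t\<close> by weak duality and
          \<open>wt\<close>.\<close>
        show "max 0 (a \<bullet> x - t) \<le> w - (\<Sum>j\<le>i. v j)" if i: "i \<le> l" and a: "a \<in> C i" for i a
          using l1_box_weak_duality[OF a[unfolded C[OF i]] x[OF i] \<gamma>[OF i] _ nn[OF i]]
            v\<gamma>[OF i] wt[OF i] w[OF i] by simp
      qed (use nested w v\<gamma> spaceP in auto)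
      also note obj
      finally have "t + 1 / (1 - \<epsilon>) * expectation (\<lambda>a. max 0 (a \<bullet> x - t)) \<le> b"
        using e by (simp add: field_simps)
      \<comment> \<open>The \<open>t\<close> of the system, the same for every \<open>P\<close>,
        bounds the infimum.\<close>
      then show "CVaR \<epsilon> P (\<lambda>a. a \<bullet> x) \<le> ereal b"
        unfolding CVaR_def by (intro INF_lower2[of t]) auto
    qed
  qed
qed

end
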